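(* (i) Let $m\ge 3$ and $n\ge 2$ be integers. In $\mathbb{C}^m\otimes\mathbb{C}^n$, the maximal number $P$ such that every set of at most $P$ mutually orthogonal product states is LOCC$_1$ distinguishable in the fixed measurement order in which the party holding $\mathbb{C}^m$ measures first is $P=3$. (ii) Let $m,n\ge 3$ be integers. In $\mathbb{C}^m\otimes\mathbb{C}^n$, the maximal number $Q$ such that every set of at most $Q$ mutually orthogonal product states is LOCC$_1$ distinguishable in a suitable measurement order (i.e. in at least one of the two orders, which may depend on the set) is $Q=4$.
   Context: Two parties, Alice holding $\mathbb{C}^m$ and Bob holding $\mathbb{C}^n$, share the system $\mathbb{C}^m\otimes\mathbb{C}^n$. A product state is a pure state of the form $|a\rangle\otimes|b\rangle$. A POVM is a finite family of positive semidefinite operators summing to the identity. An LOCC$_1$ POVM with Alice measuring first is one of the form $\{A_{j}\otimes B_{j,l}\}_{j,l}$, where $\{A_j\}_j$ is a POVM on $\mathbb{C}^m$ and, for each $j$, $\{B_{j,l}\}_l$ is a POVM on $\mathbb{C}^n$; with Bob measuring first the roles are exchanged: $\{A_{j,l}\otimes B_j\}_{j,l}$ with $\{B_j\}_j$ a POVM on $\mathbb{C}^n$ and, for each $j$, $\{A_{j,l}\}_l$ a POVM on $\mathbb{C}^m$. A set $S$ of states (written as density operators) is LOCC$_1$ distinguishable in a given order if there is an LOCC$_1$ POVM $\{M_t\}$ with that order such that for every $t$, $\mathrm{Tr}(M_t\rho)\ne 0$ for at most one $\rho\in S$. *)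

theory Defs
  imports "HOL-Analysis.Analysis"
begin

text \<open>
  \<open>\<complex>\<^sup>m\<close> is \<^typ>\<open>complex^'m\<close> with \<open>CARD('m) = m\<close>, and \<open>\<complex>\<^sup>m \<otimes> \<complex>\<^sup>n\<close> is
  \<^typ>\<open>complex^('m::finite \<times> 'n::finite)\<close>, the pair \<open>(i, j)\<close> labelling the basis vector \<open>e\<^sub>i \<otimes> e\<^sub>j\<close>.
  The library's \<^term>\<open>inner\<close> on \<^typ>\<open>complex^'m\<close> is the real part of \<open>cinner\<close> below, so
  Hermitian orthogonality has to be defined separately; the library's \<^term>\<open>norm\<close> is the
  Hermitian norm.
\<close>

definition cinner :: "complex^'d \<Rightarrow> complex^'d \<Rightarrow> complex" where
  "cinner v w = (\<Sum>i\<in>UNIV. cnj (v $ i) * w $ i)"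

definition adjoint_mat :: "complex^'d^'d \<Rightarrow> complex^'d^'d" where
  "adjoint_mat M = (\<chi> i j. cnj (M $ j $ i))"

definition pos_semidef :: "complex^'d^'d \<Rightarrow> bool" where
  "pos_semidef M \<longleftrightarrow> adjoint_mat M = M \<and> (\<forall>v. 0 \<le> Re (cinner v (M *v v)))"

definition tensor_vec :: "complex^'m \<Rightarrow> complex^'n \<Rightarrow> complex^('m::finite \<times> 'n::finite)" where
  "tensor_vec a b = (\<chi> p. a $ fst p * b $ snd p)"

definition tensor_mat ::
  "complex^'m^'m \<Rightarrow> complex^'n^'n \<Rightarrow> complex^('m::finite \<times> 'n::finite)^('m::finite \<times> 'n::finite)" where
  "tensor_mat A B = (\<chi> p q. A $ fst p $ fst q * B $ snd p $ snd q)"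

definition product_vectors :: "(complex^('m::finite \<times> 'n::finite)) set" where
  "product_vectors = {tensor_vec a b | a b. norm a = 1 \<and> norm b = 1}"

definition density_op :: "complex^'d \<Rightarrow> complex^'d^'d" where
  "density_op \<psi> = (\<chi> i j. \<psi> $ i * cnj (\<psi> $ j))"

definition mutually_orthogonal :: "(complex^'d) set \<Rightarrow> bool" where
  "mutually_orthogonal V \<longleftrightarrow> pairwise (\<lambda>\<psi> \<phi>. cinner \<psi> \<phi> = 0) V"

definition povm :: "'i set \<Rightarrow> ('i \<Rightarrow> complex^'d^'d) \<Rightarrow> bool" where
  "povm I M \<longleftrightarrow> finite I \<and> (\<forall>i\<in>I. pos_semidef (M i)) \<and> (\<Sum>i\<in>I. M i) = mat 1"

text \<open>Alice holds the first tensor factor, Bob the second.\<close>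

definition locc1_povm_alice_first ::
  "('j \<times> 'l) set \<Rightarrow> ('j \<times> 'l \<Rightarrow> complex^('m::finite \<times> 'n::finite)^('m::finite \<times> 'n::finite)) \<Rightarrow> bool" where
  "locc1_povm_alice_first T M \<longleftrightarrow>
     (\<exists>J L A B. povm J A \<and> (\<forall>j\<in>J. povm (L j) (B j)) \<and> T = Sigma J L \<and>
        (\<forall>j\<in>J. \<forall>l\<in>L j. M (j, l) = tensor_mat (A j) (B j l)))"

definition locc1_povm_bob_first ::
  "('j \<times> 'l) set \<Rightarrow> ('j \<times> 'l \<Rightarrow> complex^('m::finite \<times> 'n::finite)^('m::finite \<times> 'n::finite)) \<Rightarrow> bool" where
  "locc1_povm_bob_first T M \<longleftrightarrow>
     (\<exists>J L A B. povm J B \<and> (\<forall>j\<in>J. povm (L j) (A j)) \<and> T = Sigma J L \<and>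
        (\<forall>j\<in>J. \<forall>l\<in>L j. M (j, l) = tensor_mat (A j l) (B j)))"

definition distinguishes ::
  "'t set \<Rightarrow> ('t \<Rightarrow> complex^'d^'d) \<Rightarrow> (complex^'d^'d) set \<Rightarrow> bool" where
  "distinguishes T M S \<longleftrightarrow> (\<forall>t\<in>T. \<exists>\<^sub>\<le>\<^sub>1 \<rho>. \<rho> \<in> S \<and> trace (M t ** \<rho>) \<noteq> 0)"

text \<open>All families are finite, so taking the outcome labels in \<^typ>\<open>nat\<close> loses no generality.\<close>

definition locc1_distinguishable_alice_first ::
  "(complex^('m::finite \<times> 'n::finite)^('m::finite \<times> 'n::finite)) set \<Rightarrow> bool" where
  "locc1_distinguishable_alice_first S \<longleftrightarrow>
     (\<exists>(T :: (nat \<times> nat) set) M. locc1_povm_alice_first T M \<and> distinguishes T M S)"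

definition locc1_distinguishable_bob_first ::
  "(complex^('m::finite \<times> 'n::finite)^('m::finite \<times> 'n::finite)) set \<Rightarrow> bool" where
  "locc1_distinguishable_bob_first S \<longleftrightarrow>
     (\<exists>(T :: (nat \<times> nat) set) M. locc1_povm_bob_first T M \<and> distinguishes T M S)"

definition is_maximal_number :: "(nat \<Rightarrow> bool) \<Rightarrow> nat \<Rightarrow> bool" where
  "is_maximal_number P k \<longleftrightarrow> P k \<and> (\<forall>k'. P k' \<longrightarrow> k' \<le> k)"

end

theory Submission
  imports Defs
begin

text \<open>
  Write the states as \<open>a\<^sub>k \<otimes> b\<^sub>k\<close>. If Alice measures first, Bob has to tell the remaining \<open>b\<^sub>k\<close> apart
  on his own, so a POVM \<open>{A\<^sub>j}\<close> of Alice is a successful first step iff for every \<open>j\<close> and all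
  \<open>k \<noteq> l\<close> with \<open>b\<^sub>k\<close> not orthogonal to \<open>b\<^sub>l\<close> we have \<open>A\<^sub>j a\<^sub>k = 0\<close> or \<open>A\<^sub>j a\<^sub>l = 0\<close>. Consider the graph
  whose edges are the pairs with \<open>b\<^sub>k\<close> not orthogonal to \<open>b\<^sub>l\<close>. If it has a vertex cover on which the \<open>a\<^sub>k\<close> are
  mutually orthogonal, Alice succeeds by projecting on these \<open>a\<^sub>k\<close> and on the complement.
  Three states always have such a cover. For four states, a perfect matching with one pair
  orthogonal on Alice's side and the other on Bob's side gives one; otherwise each of the three
  matchings belongs to a single party, and the party owning at least two of them can measure first.
  The bounds are sharp because of the four states \<open>e\<^sub>0 \<otimes> f\<^sub>0\<close>, \<open>e\<^sub>1 \<otimes> f\<^sub>0\<close>, \<open>(e\<^sub>0 \<plusminus> e\<^sub>1) \<otimes> f\<^sub>1\<close>, and because of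
  the five states of the ``Tiles'' unextendible product basis: each \<open>A\<^sub>j\<close> has to annihilate a vertex
  cover of a 5-cycle, hence at least three of the \<open>a\<^sub>k\<close>, and any three of them are linearly independent.
\<close>

section \<open>Hermitian inner product and positive matrices\<close>

lemma cinner_add_right: "cinner x (y + z) = cinner x y + cinner x z"
  by (simp add: cinner_def algebra_simps sum.distrib)

lemma cinner_add_left: "cinner (x + y) z = cinner x z + cinner y z"
  by (simp add: cinner_def algebra_simps sum.distrib)

lemma cinner_diff_right: "cinner x (y - z) = cinner x y - cinner x z"
  by (simp add: cinner_def algebra_simps sum_subtractf)

lemma cinner_diff_left: "cinner (x - y) z = cinner x z - cinner y z"
  by (simp add: cinner_def algebra_simps sum_subtractf)

lemma cinner_smult_right: "cinner x (c *s y) = c * cinner x y"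
  by (simp add: cinner_def algebra_simps sum_distrib_left)

lemma cinner_smult_left: "cinner (c *s x) y = cnj c * cinner x y"
  by (simp add: cinner_def algebra_simps sum_distrib_left)

lemma cinner_zero_right [simp]: "cinner x 0 = 0"
  by (simp add: cinner_def)

lemma cinner_zero_left [simp]: "cinner 0 x = 0"
  by (simp add: cinner_def)

lemma cinner_sum_right: "cinner x (\<Sum>i\<in>I. f i) = (\<Sum>i\<in>I. cinner x (f i))"
  by (induction I rule: infinite_finite_induct) (auto simp: cinner_add_right)

lemma cnj_cinner: "cnj (cinner x y) = cinner y x"
  by (simp add: cinner_def mult.commute)

lemma cinner_eq_0_commute: "cinner x y = 0 \<longleftrightarrow> cinner y x = 0"
  by (metis cnj_cinner complex_cnj_zero)

lemma cinner_self: "cinner x x = of_real ((norm x)\<^sup>2)"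
proof -
  have "(norm x)\<^sup>2 = (\<Sum>i\<in>UNIV. (norm (x $ i))\<^sup>2)"
    by (simp add: norm_vec_def L2_set_def sum_nonneg)
  moreover have "cnj (x $ i) * x $ i = of_real ((norm (x $ i))\<^sup>2)" for i
    by (metis complex_norm_square mult.commute)
  ultimately show ?thesis
    unfolding cinner_def by (simp only: of_real_sum)
qed

lemma cinner_self_eq_0 [simp]: "cinner x x = 0 \<longleftrightarrow> x = 0"
  by (simp add: cinner_self)

lemma cinner_axis: "cinner (axis i 1) (axis j 1) = (if i = j then 1 else 0)"
proof -
  have "cinner (axis i 1) (axis j 1) = (\<Sum>k\<in>UNIV. if k = i then axis j 1 $ k else 0)"
    unfolding cinner_def by (intro sum.cong) (auto simp: axis_def)
  then show ?thesis by (simp add: axis_def)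
qed

lemma scaleR_eq_smult: "r *\<^sub>R (x :: complex^'d) = complex_of_real r *s x"
  by (simp add: vec_eq_iff scaleR_conv_of_real[where 'a = complex])

lemma cinner_sgn_eq_0:
  assumes "x \<noteq> 0" "y \<noteq> 0"
  shows "cinner (sgn x) (sgn y) = 0 \<longleftrightarrow> cinner x y = 0"
  using assms by (simp add: sgn_div_norm scaleR_eq_smult cinner_smult_left cinner_smult_right)

lemma matrix_vector_mult_smult: "A *v (c *s (x :: complex^'d)) = c *s (A *v x)"
  by (simp add: vec_eq_iff matrix_vector_mult_def sum_distrib_left algebra_simps)

lemma matrix_vector_mult_sum: "(\<Sum>i\<in>I. M i) *v (x :: complex^'d) = (\<Sum>i\<in>I. M i *v x)"
  by (induction I rule: infinite_finite_induct) (auto simp: matrix_vector_mult_add_rdistrib)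

lemma matrix_vector_mult_sum_right: "A *v (\<Sum>i\<in>I. f i) = (\<Sum>i\<in>I. A *v (f i :: complex^'d))"
  by (induction I rule: infinite_finite_induct) (auto simp: matrix_vector_right_distrib)

lemma matrix_vector_mult_sgn_eq_0:
  assumes "(x :: complex^'d) \<noteq> 0"
  shows "A *v sgn x = 0 \<longleftrightarrow> A *v x = 0"
  using assms by (simp add: sgn_div_norm scaleR_eq_smult matrix_vector_mult_smult)

section \<open>Adjoints and positive semidefinite operators\<close>

lemma cinner_adjoint: "cinner x (A *v y) = cinner (adjoint_mat A *v x) y"
proof -
  have "cinner x (A *v y) = (\<Sum>i\<in>UNIV. \<Sum>j\<in>UNIV. cnj (x $ i) * (A $ i $ j * y $ j))"
    by (simp add: cinner_def matrix_vector_mult_def sum_distrib_left)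
  also have "\<dots> = (\<Sum>j\<in>UNIV. \<Sum>i\<in>UNIV. cnj (x $ i) * (A $ i $ j * y $ j))"
    by (rule sum.swap)
  also have "\<dots> = cinner (adjoint_mat A *v x) y"
    by (simp add: cinner_def matrix_vector_mult_def adjoint_mat_def sum_distrib_left
        sum_distrib_right algebra_simps)
  finally show ?thesis .
qed

lemma pos_semidef_cinner: "pos_semidef A \<Longrightarrow> cinner x (A *v y) = cinner (A *v x) y"
  by (simp add: pos_semidef_def cinner_adjoint)

lemma adjoint_mat_diff: "adjoint_mat (A - B) = adjoint_mat A - adjoint_mat B"
  by (simp add: adjoint_mat_def vec_eq_iff)

lemma adjoint_mat_sum: "adjoint_mat (\<Sum>i\<in>I. M i) = (\<Sum>i\<in>I. adjoint_mat (M i))"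
  by (simp add: adjoint_mat_def vec_eq_iff)

lemma adjoint_mat_one: "adjoint_mat (mat 1) = mat 1"
  by (auto simp: adjoint_mat_def mat_def vec_eq_iff)

lemma pos_semidef_projector:
  assumes "adjoint_mat M = M" and idem: "\<And>v. M *v (M *v v) = M *v v"
  shows "pos_semidef M"
proof -
  have "0 \<le> Re (cinner v (M *v v))" for v
  proof -
    have "cinner v (M *v v) = cinner (M *v v) (M *v v)"
      using cinner_adjoint[of v M "M *v v"] assms by simp
    then show ?thesis by (simp add: cinner_self del: of_real_power)
  qed
  with assms show ?thesis by (simp add: pos_semidef_def)
qed

text \<open>Perturb \<open>x\<close> along \<open>y = A *v x\<close>: the form at
  \<open>x + t *s y\<close> has real part \<open>2*t*p + t^2*q\<close>, which is negative for small
  negative \<open>t\<close> if \<open>y\<close> is nonzero. This turns a vanishing outcome weight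
  into a vanishing vector.\<close>

lemma pos_semidef_kernel:
  assumes A: "pos_semidef A" and x: "cinner x (A *v x) = 0"
  shows "A *v x = 0"
proof (rule ccontr)
  assume "A *v x \<noteq> 0"
  define y where "y = A *v x"
  define p where "p = (norm y)\<^sup>2"
  define q where "q = Re (cinner y (A *v y))"
  have p: "p > 0" using \<open>A *v x \<noteq> 0\<close> by (simp add: p_def y_def)
  have q: "q \<ge> 0" using A by (simp add: q_def pos_semidef_def)
  \<comment> \<open>The denominator \<open>q + 1\<close> stays positive even for
    \<open>q = 0\<close>, and with this choice the form equals \<open>t * (p - t)\<close>, a
    negative number times a positive one.\<close>
  define t where "t = - p / (q + 1)"
  define w where "w = x + complex_of_real t *s y"
  have "A *v w = y + complex_of_real t *s (A *v y)"
    by (simp add: w_def y_def matrix_vector_right_distrib matrix_vector_mult_smult)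
  moreover have "cinner x (A *v y) = cinner y y"
    using pos_semidef_cinner[OF A, of x y] by (simp add: y_def)
  moreover have "cinner x y = 0" using x by (simp add: y_def)
  ultimately have "cinner w (A *v w)
      = 2 * complex_of_real t * cinner y y + complex_of_real (t\<^sup>2) * cinner y (A *v y)"
    by (simp add: w_def cinner_add_left cinner_add_right cinner_smult_left cinner_smult_right
        algebra_simps power2_eq_square)
  then have "Re (cinner w (A *v w)) = 2 * t * p + t\<^sup>2 * q"
    by (simp add: cinner_self p_def q_def del: of_real_power)
  moreover have "0 \<le> Re (cinner w (A *v w))" using A by (simp add: pos_semidef_def)
  ultimately have nonneg: "0 \<le> 2 * t * p + t\<^sup>2 * q" by simp
  have "t < 0" using p q by (simp add: t_def divide_neg_pos)
  moreover have "t * (q + 1) = - p" using q by (simp add: t_def)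
  then have "t * q = - p - t" by (simp add: algebra_simps)
  then have "2 * t * p + t\<^sup>2 * q = t * (p - t)"
    by (simp add: power2_eq_square mult.assoc) (simp add: algebra_simps)
  ultimately show False using nonneg p by (smt (verit) mult_neg_pos)
qed

section \<open>Measuring in an orthonormal set\<close>

definition orthonormal :: "(complex^'d) set \<Rightarrow> bool" where
  "orthonormal U \<longleftrightarrow> finite U \<and> (\<forall>u\<in>U. \<forall>v\<in>U. cinner u v = (if u = v then 1 else 0))"

definition orthoproj :: "(complex^'d) set \<Rightarrow> complex^'d^'d" where
  "orthoproj U = (\<Sum>u\<in>U. density_op u)"

lemma density_op_mult: "density_op u *v x = cinner u x *s u"
  by (simp add: density_op_def matrix_vector_mult_def cinner_def vec_eq_iff sum_distrib_left
      sum_distrib_right algebra_simps)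

lemma adjoint_density_op: "adjoint_mat (density_op u) = density_op u"
  by (simp add: density_op_def adjoint_mat_def vec_eq_iff mult.commute)

lemma orthoproj_mult: "orthoproj U *v x = (\<Sum>u\<in>U. cinner u x *s u)"
  by (simp add: orthoproj_def matrix_vector_mult_sum density_op_mult)

lemma orthoproj_fixes:
  assumes "orthonormal U" "u \<in> U"
  shows "orthoproj U *v u = u"
proof -
  have "orthoproj U *v u = (\<Sum>v\<in>U. if v = u then u else 0)"
    unfolding orthoproj_mult using assms by (intro sum.cong) (auto simp: orthonormal_def)
  then show ?thesis using assms by (simp add: orthonormal_def)
qed

lemma orthoproj_idem:
  assumes "orthonormal U"
  shows "orthoproj U *v (orthoproj U *v x) = orthoproj U *v x"
proof -
  have "orthoproj U *v (\<Sum>u\<in>U. cinner u x *s u) = (\<Sum>u\<in>U. cinner u x *s (orthoproj U *v u))"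
    by (simp add: matrix_vector_mult_sum_right matrix_vector_mult_smult)
  also have "\<dots> = (\<Sum>u\<in>U. cinner u x *s u)"
    using assms by (intro sum.cong) (auto simp: orthoproj_fixes)
  finally show ?thesis by (simp add: orthoproj_mult)
qed

text \<open>A projective measurement: one rank-one outcome for each element of \<open>U\<close>, and
  one outcome for the orthogonal complement of their span.\<close>

lemma orthonormal_povm:
  fixes U :: "(complex^'d) set"
  assumes U: "orthonormal U"
  obtains J and A :: "nat \<Rightarrow> complex^'d^'d"
  where "povm J A" "\<And>j. j \<in> J \<Longrightarrow> (\<exists>u\<in>U. A j = density_op u) \<or> A j = mat 1 - orthoproj U"
proof -
  have fin: "finite U" using U by (simp add: orthonormal_def)
  define n where "n = card U"
  obtain f where f: "bij_betw f {0..<n} U"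
    using ex_bij_betw_nat_finite[OF fin] n_def by blast
  \<comment> \<open>The enumeration \<open>f\<close> uses the labels below
    \<open>n = card U\<close>; label \<open>n\<close> itself carries the complement, so the outcomes
    are \<open>{..n}\<close>.\<close>
  define A where "A j = (if j < n then density_op (f j) else mat 1 - orthoproj U)" for j
  have fU: "f j \<in> U" if "j < n" for j using f that by (auto simp: bij_betw_def)
  have "pos_semidef (density_op u)" if "u \<in> U" for u
    using U that
    by (intro pos_semidef_projector)
      (auto simp: adjoint_density_op density_op_mult cinner_smult_right orthonormal_def)
  moreover have "pos_semidef (mat 1 - orthoproj U)"
  proof (rule pos_semidef_projector)
    show "adjoint_mat (mat 1 - orthoproj U) = mat 1 - orthoproj U"
      by (simp add: adjoint_mat_diff adjoint_mat_one orthoproj_def adjoint_mat_sum adjoint_density_op)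
    show "(mat 1 - orthoproj U) *v ((mat 1 - orthoproj U) *v v) = (mat 1 - orthoproj U) *v v" for v
      by (simp add: orthoproj_idem[OF U] matrix_vector_mult_diff_rdistrib
          matrix_vector_mult_diff_distrib)
  qed
  moreover have "(\<Sum>j\<in>{..n}. A j) = mat 1"
  proof -
    have "(\<Sum>j<n. A j) = (\<Sum>j\<in>{0..<n}. density_op (f j))"
      by (auto simp: A_def lessThan_atLeast0)
    also have "\<dots> = orthoproj U"
      unfolding orthoproj_def by (rule sum.reindex_bij_betw[OF f])
    finally show ?thesis
      by (simp add: lessThan_Suc_atMost[symmetric]) (simp add: A_def)
  qed
  ultimately have "povm {..n} A" using fU by (auto simp: povm_def A_def)
  moreover have "(\<exists>u\<in>U. A j = density_op u) \<or> A j = mat 1 - orthoproj U" for j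
    using fU by (auto simp: A_def)
  ultimately show thesis using that by blast
qed

text \<open>A unit vector is not orthogonal to itself, so distinct labels in \<open>C\<close> give
  distinct vectors.\<close>

lemma orthonormal_image:
  assumes "finite C" "\<And>k. k \<in> C \<Longrightarrow> norm (a k) = 1"
    and "\<And>k l. \<lbrakk>k \<in> C; l \<in> C; k \<noteq> l\<rbrakk> \<Longrightarrow> cinner (a k) (a l) = 0"
  shows "orthonormal (a ` C)"
proof -
  have "cinner (a k) (a l) = (if a k = a l then 1 else 0)" if "k \<in> C" "l \<in> C" for k l
    using that assms(2,3)[of k] assms(2)[of l] assms(3)[of k l] by (auto simp: cinner_self)
  then show ?thesis using assms(1) by (auto simp: orthonormal_def)
qed

text \<open>Gram-Schmidt for two vectors, with \<open>U = {x}\<close> if \<open>y\<close> is a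
  multiple of \<open>x\<close>. The last clause says that \<open>U\<close> stays inside the span of
  \<open>x\<close> and \<open>y\<close>, in the form in which \<open>one_way_4_cycle\<close> uses
  it.\<close>

lemma orthonormal_basis_of_pair:
  fixes x y :: "complex^'d"
  assumes x: "norm x = 1"
  obtains U where "orthonormal U" "orthoproj U *v x = x" "orthoproj U *v y = y"
    "\<And>u z. \<lbrakk>u \<in> U; cinner x z = 0; cinner y z = 0\<rbrakk> \<Longrightarrow> cinner u z = 0"
proof -
  define r where "r = y - cinner x y *s x"
  have xx: "cinner x x = 1" using x by (simp add: cinner_self)
  have xr: "cinner x r = 0" by (simp add: r_def cinner_diff_right cinner_smult_right xx)
  have y: "y = cinner x y *s x + r" by (simp add: r_def)
  show thesis
  proof (cases "r = 0")
    case True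
    have "orthonormal {x}" using xx by (simp add: orthonormal_def)
    moreover have "orthoproj {x} *v x = x" by (simp add: orthoproj_mult xx)
    moreover have "orthoproj {x} *v y = y" using y True by (simp add: orthoproj_mult)
    ultimately show ?thesis using that[of "{x}"] by auto
  next
    case False
    define s where "s = sgn r"
    define c where "c = complex_of_real (norm r)"
    have r: "r = c *s s" using False
      by (simp add: s_def c_def sgn_div_norm scaleR_eq_smult)
    have c: "c \<noteq> 0" using False by (simp add: c_def)
    have ss: "cinner s s = 1" using False by (simp add: s_def cinner_self norm_sgn)
    have xs: "cinner x s = 0" using xr c by (simp add: r cinner_smult_right)
    then have sx: "cinner s x = 0" using cinner_eq_0_commute by blast
    have on: "orthonormal {x, s}" using xx ss xs sx by (auto simp: orthonormal_def)
    have px: "orthoproj {x, s} *v x = x" by (rule orthoproj_fixes[OF on]) simp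
    have ps: "orthoproj {x, s} *v s = s" by (rule orthoproj_fixes[OF on]) simp
    have "orthoproj {x, s} *v y = cinner x y *s (orthoproj {x, s} *v x) + c *s (orthoproj {x, s} *v s)"
      using y r by (metis matrix_vector_right_distrib matrix_vector_mult_smult)
    then have py: "orthoproj {x, s} *v y = y" using y r px ps by simp
    have "cinner s z = 0" if "cinner x z = 0" "cinner y z = 0" for z
    proof -
      have "cinner r z = 0" using that by (simp add: r_def cinner_diff_left cinner_smult_left)
      then show ?thesis using c by (simp add: r cinner_smult_left)
    qed
    then show ?thesis using that[OF on px py] by auto
  qed
qed

section \<open>One-way distinguishability of product states\<close>

text \<open>The second measurement is eliminated: after each outcome the surviving states must have
  mutually orthogonal second factors. Exchanging \<open>a\<close> and \<open>b\<close> describes the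
  other order.\<close>

definition one_way :: "'k set \<Rightarrow> ('k \<Rightarrow> complex^'m) \<Rightarrow> ('k \<Rightarrow> complex^'n) \<Rightarrow> bool" where
  "one_way K a b \<longleftrightarrow> (\<exists>(J :: nat set) A. povm J A \<and> (\<forall>j\<in>J. \<forall>k\<in>K. \<forall>l\<in>K. k \<noteq> l \<longrightarrow>
      cinner (b k) (b l) = 0 \<or> A j *v a k = 0 \<or> A j *v a l = 0))"

lemma sum_UNIV_prod: "(\<Sum>p\<in>UNIV. f (p :: 'm::finite \<times> 'n::finite)) = (\<Sum>i\<in>UNIV. \<Sum>j\<in>UNIV. f (i, j))"
  by (simp add: sum.cartesian_product)

lemma cinner_tensor_vec: "cinner (tensor_vec a b) (tensor_vec c d) = cinner a c * cinner b d"
  by (simp add: cinner_def tensor_vec_def sum_UNIV_prod sum_product mult_ac)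

lemma norm_tensor_vec: "norm (tensor_vec a b) = norm a * norm b"
proof -
  have "complex_of_real ((norm (tensor_vec a b))\<^sup>2) = of_real ((norm a * norm b)\<^sup>2)"
    using cinner_tensor_vec[of a b a b] by (simp add: cinner_self power_mult_distrib)
  then have "(norm (tensor_vec a b))\<^sup>2 = (norm a * norm b)\<^sup>2"
    using of_real_eq_iff by blast
  then show ?thesis by (rule power2_eq_imp_eq) auto
qed

lemma tensor_mat_mult: "tensor_mat A B *v tensor_vec a b = tensor_vec (A *v a) (B *v b)"
  by (simp add: matrix_vector_mult_def tensor_vec_def tensor_mat_def vec_eq_iff sum_UNIV_prod
      sum_product mult_ac)

lemma trace_density_op: "trace (M ** density_op x) = cinner x (M *v x)"
  by (simp add: trace_def matrix_matrix_mult_def density_op_def cinner_def matrix_vector_mult_def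
      sum_distrib_left mult_ac)

lemma trace_tensor:
  "trace (tensor_mat A B ** density_op (tensor_vec a b)) = cinner a (A *v a) * cinner b (B *v b)"
  by (simp add: trace_density_op tensor_mat_mult cinner_tensor_vec)

text \<open>\<open>density_op x\<close> fixes \<open>x\<close>, whereas \<open>density_op y\<close>
  annihilates it. Hence distinct labels give distinct density operators, and counting operators
  amounts to counting labels.\<close>

lemma density_op_neq:
  assumes "norm x = 1" "cinner x y = 0"
  shows "density_op x \<noteq> density_op y"
proof
  assume "density_op x = density_op y"
  then have "density_op x *v x = density_op y *v x" by simp
  moreover have "cinner y x = 0" using assms cinner_eq_0_commute by blast
  ultimately show False using assms by (auto simp: density_op_mult cinner_self)
qed

section \<open>POVMs that separate vectors, and orthogonality\<close>

lemma povm_resolution: "povm I M \<Longrightarrow> (\<Sum>i\<in>I. M i *v x) = (x :: complex^'d)"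
  by (metis povm_def matrix_vector_mult_sum matrix_vector_mul_lid)

text \<open>Resolve \<open>y\<close> as the sum of all \<open>B l *v y\<close>. Each term is
  orthogonal to \<open>x\<close>, because \<open>B l\<close> can be moved to the other side of
  \<open>cinner\<close>.\<close>

lemma povm_separates_imp_orthogonal:
  assumes "povm L B" "\<And>l. l \<in> L \<Longrightarrow> B l *v x = 0 \<or> B l *v y = 0"
  shows "cinner x y = 0"
proof -
  have "cinner x (B l *v y) = 0" if "l \<in> L" for l
  proof -
    have "cinner x (B l *v y) = cinner (B l *v x) y"
      using assms(1) that by (intro pos_semidef_cinner) (auto simp: povm_def)
    then show ?thesis using assms(2)[OF that] by auto
  qed
  then have "cinner x (\<Sum>l\<in>L. B l *v y) = 0" by (simp add: cinner_sum_right)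
  then show ?thesis using povm_resolution[OF assms(1)] by simp
qed

lemma orthogonal_imp_povm_separates:
  fixes b :: "'k \<Rightarrow> complex^'n"
  assumes "finite W" "\<And>k. k \<in> W \<Longrightarrow> norm (b k) = 1"
    and orth: "\<And>k l. \<lbrakk>k \<in> W; l \<in> W; k \<noteq> l\<rbrakk> \<Longrightarrow> cinner (b k) (b l) = 0"
  shows "\<exists>(L :: nat set) B. povm L B \<and>
    (\<forall>i\<in>L. \<forall>k\<in>W. \<forall>l\<in>W. k \<noteq> l \<longrightarrow> B i *v b k = 0 \<or> B i *v b l = 0)"
proof -
  have on: "orthonormal (b ` W)" using assms by (rule orthonormal_image)
  obtain L and B :: "nat \<Rightarrow> complex^'n^'n" where LB: "povm L B"
    "\<And>j. j \<in> L \<Longrightarrow> (\<exists>u\<in>b ` W. B j = density_op u) \<or> B j = mat 1 - orthoproj (b ` W)"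
    using orthonormal_povm[OF on] by blast
  have "B i *v b k = 0 \<or> B i *v b l = 0" if "i \<in> L" "k \<in> W" "l \<in> W" "k \<noteq> l" for i k l
    using LB(2)[OF that(1)]
  proof
    assume "\<exists>u\<in>b ` W. B i = density_op u"
    then obtain w where "w \<in> W" "B i = density_op (b w)" by auto
    then show ?thesis using orth[of w k] orth[of w l] that by (auto simp: density_op_mult)
  next
    assume "B i = mat 1 - orthoproj (b ` W)"
    then show ?thesis using orthoproj_fixes[OF on] that
      by (simp add: matrix_vector_mult_diff_rdistrib)
  qed
  with LB(1) show ?thesis by blast
qed

text \<open>Only the products of outcome weights matter here, which makes the two orders symmetric.\<close>

lemma one_wayE:
  fixes a :: "'k \<Rightarrow> complex^'m" and b :: "'k \<Rightarrow> complex^'n"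
  assumes "one_way K a b" and fin: "finite K" and b: "\<And>k. k \<in> K \<Longrightarrow> norm (b k) = 1"
  obtains J :: "nat set" and L :: "nat \<Rightarrow> nat set" and A B
  where "povm J A" "\<forall>j\<in>J. povm (L j) (B j)"
    "\<forall>j\<in>J. \<forall>i\<in>L j. \<forall>k\<in>K. \<forall>l\<in>K. k \<noteq> l \<longrightarrow>
        cinner (a k) (A j *v a k) * cinner (b k) (B j i *v b k) = 0 \<or>
        cinner (a l) (A j *v a l) * cinner (b l) (B j i *v b l) = 0"
proof -
  from assms(1) obtain J :: "nat set" and A where JA: "povm J A"
    and sep: "\<forall>j\<in>J. \<forall>k\<in>K. \<forall>l\<in>K. k \<noteq> l \<longrightarrow>
      cinner (b k) (b l) = 0 \<or> A j *v a k = 0 \<or> A j *v a l = 0"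
    unfolding one_way_def by (elim exE conjE)
  define Q :: "nat \<Rightarrow> nat set \<Rightarrow> (nat \<Rightarrow> complex^'n^'n) \<Rightarrow> bool" where
    "Q j L B \<longleftrightarrow> povm L B \<and> (\<forall>i\<in>L. \<forall>k\<in>K. \<forall>l\<in>K. k \<noteq> l \<longrightarrow>
      A j *v a k = 0 \<or> A j *v a l = 0 \<or> B i *v b k = 0 \<or> B i *v b l = 0)" for j L B
  have "\<exists>L B. Q j L B" if j: "j \<in> J" for j
  proof -
    \<comment> \<open>The states that survive outcome \<open>j\<close>. By \<open>sep\<close> their
      second factors are mutually orthogonal, so a second measurement can separate them.\<close>
    define W where "W = {k\<in>K. A j *v a k \<noteq> 0}"
    have fin_W: "finite W" using fin by (simp add: W_def)
    have norm_W: "norm (b k) = 1" if "k \<in> W" for k using b that by (simp add: W_def)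
    have orth_W: "cinner (b k) (b l) = 0" if "k \<in> W" "l \<in> W" "k \<noteq> l" for k l
      using sep j that unfolding W_def by blast
    have "\<exists>(L :: nat set) B. povm L B \<and>
        (\<forall>i\<in>L. \<forall>k\<in>W. \<forall>l\<in>W. k \<noteq> l \<longrightarrow> B i *v b k = 0 \<or> B i *v b l = 0)"
      by (rule orthogonal_imp_povm_separates[OF fin_W norm_W orth_W])
    then obtain L and B :: "nat \<Rightarrow> complex^'n^'n" where LB: "povm L B"
      "\<forall>i\<in>L. \<forall>k\<in>W. \<forall>l\<in>W. k \<noteq> l \<longrightarrow> B i *v b k = 0 \<or> B i *v b l = 0"
      by (elim exE conjE)
    have "A j *v a k = 0 \<or> A j *v a l = 0 \<or> B i *v b k = 0 \<or> B i *v b l = 0"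
      if "i \<in> L" "k \<in> K" "l \<in> K" "k \<noteq> l" for i k l
      using LB(2) that by (auto simp: W_def)
    with LB(1) have "Q j L B" unfolding Q_def by simp
    then show ?thesis by blast
  qed
  then obtain L :: "nat \<Rightarrow> nat set" and B where
    LB: "\<And>j. j \<in> J \<Longrightarrow> Q j (L j) (B j)"
    by metis
  show thesis
  proof (rule that[OF JA])
    show "\<forall>j\<in>J. povm (L j) (B j)" using LB unfolding Q_def by blast
    show "\<forall>j\<in>J. \<forall>i\<in>L j. \<forall>k\<in>K. \<forall>l\<in>K. k \<noteq> l \<longrightarrow>
        cinner (a k) (A j *v a k) * cinner (b k) (B j i *v b k) = 0 \<or>
        cinner (a l) (A j *v a l) * cinner (b l) (B j i *v b l) = 0"
    proof (intro ballI impI)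
      fix j i k l assume "j \<in> J" "i \<in> L j" "k \<in> K" "l \<in> K" "k \<noteq> l"
      then have "A j *v a k = 0 \<or> A j *v a l = 0 \<or> B j i *v b k = 0 \<or> B j i *v b l = 0"
        using LB unfolding Q_def by blast
      then show "cinner (a k) (A j *v a k) * cinner (b k) (B j i *v b k) = 0 \<or>
          cinner (a l) (A j *v a l) * cinner (b l) (B j i *v b l) = 0"
        by auto
    qed
  qed
qed

text \<open>If both \<open>k\<close> and \<open>l\<close> survive outcome \<open>j\<close>, their
  first weights are nonzero by \<open>pos_semidef_kernel\<close>. The vanishing products then force
  every second outcome to annihilate \<open>b k\<close> or \<open>b l\<close>, so these are
  orthogonal.\<close>

lemma one_wayI:
  fixes J :: "nat set" and L :: "nat \<Rightarrow> nat set"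
  assumes JA: "povm J A" and "\<forall>j\<in>J. povm (L j) (B j)"
    and "\<forall>j\<in>J. \<forall>i\<in>L j. \<forall>k\<in>K. \<forall>l\<in>K. k \<noteq> l \<longrightarrow>
        cinner (a k) (A j *v a k) * cinner (b k) (B j i *v b k) = 0 \<or>
        cinner (a l) (A j *v a l) * cinner (b l) (B j i *v b l) = 0"
  shows "one_way K a b"
proof -
  have LB: "povm (L j) (B j)" if "j \<in> J" for j using assms(2) that by blast
  have "cinner (b k) (b l) = 0 \<or> A j *v a k = 0 \<or> A j *v a l = 0"
    if jkl: "j \<in> J" "k \<in> K" "l \<in> K" "k \<noteq> l" for j k l
  proof (cases "A j *v a k = 0 \<or> A j *v a l = 0")
    case False
    have A: "pos_semidef (A j)" using JA jkl by (auto simp: povm_def)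
    have B: "pos_semidef (B j i)" if "i \<in> L j" for i using LB jkl that by (auto simp: povm_def)
    have "cinner (b k) (b l) = 0"
    proof (rule povm_separates_imp_orthogonal[OF LB[OF jkl(1)]])
      fix i assume i: "i \<in> L j"
      have "cinner (b k) (B j i *v b k) = 0 \<or> cinner (b l) (B j i *v b l) = 0"
        using assms(3)[rule_format, OF jkl(1) i jkl(2-4)] False pos_semidef_kernel[OF A] by auto
      then show "B j i *v b k = 0 \<or> B j i *v b l = 0" using pos_semidef_kernel[OF B[OF i]] by auto
    qed
    then show ?thesis ..
  qed auto
  then show ?thesis unfolding one_way_def using JA by blast
qed

section \<open>From LOCC1 distinguishability of product states to \<open>one_way\<close>\<close>

lemma Uniq_image_iff:
  assumes "inj_on f K"
  shows "(\<exists>\<^sub>\<le>\<^sub>1 y. y \<in> f ` K \<and> P y) \<longleftrightarrow> (\<forall>k\<in>K. \<forall>l\<in>K. k \<noteq> l \<longrightarrow> \<not> P (f k) \<or> \<not> P (f l))"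
proof -
  have "(\<exists>\<^sub>\<le>\<^sub>1 y. y \<in> f ` K \<and> P y) \<longleftrightarrow> (\<forall>k\<in>K. \<forall>l\<in>K. P (f k) \<longrightarrow> P (f l) \<longrightarrow> f l = f k)"
    unfolding Uniq_def by blast
  moreover have "f l = f k \<longleftrightarrow> l = k" if "k \<in> K" "l \<in> K" for k l
    using assms that by (simp add: inj_on_eq_iff)
  ultimately show ?thesis by auto
qed

text \<open>The labels are arbitrary: the vectors themselves serve as labels for a given set, list
  positions for the counterexamples.\<close>

locale product_states =
  fixes K :: "'k set" and a :: "'k \<Rightarrow> complex^'m::finite" and b :: "'k \<Rightarrow> complex^'n::finite"
  assumes finite_K: "finite K"
    and norm_a: "k \<in> K \<Longrightarrow> norm (a k) = 1"
    and norm_b: "k \<in> K \<Longrightarrow> norm (b k) = 1"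
    and orth: "\<lbrakk>k \<in> K; l \<in> K; k \<noteq> l\<rbrakk> \<Longrightarrow> cinner (a k) (a l) = 0 \<or> cinner (b k) (b l) = 0"
begin

abbreviation states :: "(complex^('m \<times> 'n)) set" where
  "states \<equiv> (\<lambda>k. tensor_vec (a k) (b k)) ` K"

lemma states_product: "states \<subseteq> product_vectors"
  using norm_a norm_b by (auto simp: product_vectors_def)

lemma states_orthogonal: "mutually_orthogonal states"
  using orth by (fastforce simp: mutually_orthogonal_def pairwise_def cinner_tensor_vec)

lemma at_most_one_state_iff:
  "(\<exists>\<^sub>\<le>\<^sub>1 \<rho>. \<rho> \<in> density_op ` states \<and> trace (M ** \<rho>) \<noteq> 0) \<longleftrightarrow>
   (\<forall>k\<in>K. \<forall>l\<in>K. k \<noteq> l \<longrightarrow> trace (M ** density_op (tensor_vec (a k) (b k))) = 0 \<or>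
      trace (M ** density_op (tensor_vec (a l) (b l))) = 0)"
proof -
  have "density_op (tensor_vec (a k) (b k)) \<noteq> density_op (tensor_vec (a l) (b l))"
    if "k \<in> K" "l \<in> K" "k \<noteq> l" for k l
  proof (rule density_op_neq)
    show "norm (tensor_vec (a k) (b k)) = 1"
      using that by (simp add: norm_tensor_vec norm_a norm_b)
    show "cinner (tensor_vec (a k) (b k)) (tensor_vec (a l) (b l)) = 0"
      using orth[OF that] by (auto simp: cinner_tensor_vec)
  qed
  then have "inj_on (\<lambda>k. density_op (tensor_vec (a k) (b k))) K" by (meson inj_onI)
  from Uniq_image_iff[OF this, of "\<lambda>\<rho>. trace (M ** \<rho>) \<noteq> 0"] show ?thesis
    by (simp only: image_image not_not)
qed

text \<open>By \<open>trace_tensor\<close> the trace at outcome \<open>(j, l)\<close> is the product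
  of the two local weights, which is what \<open>one_wayI\<close> and \<open>one_wayE\<close> speak
  about.\<close>

lemma alice_first_iff: "locc1_distinguishable_alice_first (density_op ` states) \<longleftrightarrow> one_way K a b"
proof
  assume "locc1_distinguishable_alice_first (density_op ` states)"
  then obtain J L A B M where povm: "povm (J :: nat set) A" "\<forall>j\<in>J. povm (L j :: nat set) (B j)"
    and "\<forall>j\<in>J. \<forall>l\<in>L j. M (j, l) = tensor_mat (A j) (B j l)"
    "distinguishes (Sigma J L) M (density_op ` states)"
    unfolding locc1_distinguishable_alice_first_def locc1_povm_alice_first_def by blast
  then have "\<forall>j\<in>J. \<forall>i\<in>L j. \<forall>k\<in>K. \<forall>l\<in>K. k \<noteq> l \<longrightarrow>
        cinner (a k) (A j *v a k) * cinner (b k) (B j i *v b k) = 0 \<or>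
        cinner (a l) (A j *v a l) * cinner (b l) (B j i *v b l) = 0"
    by (fastforce simp: distinguishes_def at_most_one_state_iff trace_tensor)
  with povm show "one_way K a b" by (rule one_wayI)
next
  assume "one_way K a b"
  then obtain J L A B where "povm (J :: nat set) A" "\<forall>j\<in>J. povm (L j :: nat set) (B j)"
    and sep: "\<forall>j\<in>J. \<forall>i\<in>L j. \<forall>k\<in>K. \<forall>l\<in>K. k \<noteq> l \<longrightarrow>
        cinner (a k) (A j *v a k) * cinner (b k) (B j i *v b k) = 0 \<or>
        cinner (a l) (A j *v a l) * cinner (b l) (B j i *v b l) = 0"
    by (rule one_wayE[OF _ finite_K norm_b])
  define M where "M = (\<lambda>(j, l). tensor_mat (A j) (B j l))"
  have "locc1_povm_alice_first (Sigma J L) M"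
    unfolding locc1_povm_alice_first_def
    using \<open>povm J A\<close> \<open>\<forall>j\<in>J. povm (L j) (B j)\<close> by (auto simp: M_def)
  moreover have "distinguishes (Sigma J L) M (density_op ` states)"
    unfolding distinguishes_def at_most_one_state_iff
    using sep by (auto simp only: M_def trace_tensor split: prod.splits)
  ultimately show "locc1_distinguishable_alice_first (density_op ` states)"
    unfolding locc1_distinguishable_alice_first_def by blast
qed

lemma bob_first_iff: "locc1_distinguishable_bob_first (density_op ` states) \<longleftrightarrow> one_way K b a"
proof
  assume "locc1_distinguishable_bob_first (density_op ` states)"
  then obtain J L A B M where povm: "povm (J :: nat set) B" "\<forall>j\<in>J. povm (L j :: nat set) (A j)"
    and "\<forall>j\<in>J. \<forall>l\<in>L j. M (j, l) = tensor_mat (A j l) (B j)"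
    "distinguishes (Sigma J L) M (density_op ` states)"
    unfolding locc1_distinguishable_bob_first_def locc1_povm_bob_first_def by blast
  then have "\<forall>j\<in>J. \<forall>i\<in>L j. \<forall>k\<in>K. \<forall>l\<in>K. k \<noteq> l \<longrightarrow>
        cinner (b k) (B j *v b k) * cinner (a k) (A j i *v a k) = 0 \<or>
        cinner (b l) (B j *v b l) * cinner (a l) (A j i *v a l) = 0"
    by (fastforce simp: distinguishes_def at_most_one_state_iff trace_tensor)
  with povm show "one_way K b a" by (rule one_wayI)
next
  assume "one_way K b a"
  then obtain J L A B where "povm (J :: nat set) B" "\<forall>j\<in>J. povm (L j :: nat set) (A j)"
    and sep: "\<forall>j\<in>J. \<forall>i\<in>L j. \<forall>k\<in>K. \<forall>l\<in>K. k \<noteq> l \<longrightarrow>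
        cinner (b k) (B j *v b k) * cinner (a k) (A j i *v a k) = 0 \<or>
        cinner (b l) (B j *v b l) * cinner (a l) (A j i *v a l) = 0"
    by (rule one_wayE[OF _ finite_K norm_a])
  define M where "M = (\<lambda>(j, l). tensor_mat (A j l) (B j))"
  have "locc1_povm_bob_first (Sigma J L) M"
    unfolding locc1_povm_bob_first_def
    using \<open>povm J B\<close> \<open>\<forall>j\<in>J. povm (L j) (A j)\<close> by (auto simp: M_def)
  moreover have "distinguishes (Sigma J L) M (density_op ` states)"
    unfolding distinguishes_def at_most_one_state_iff
    using sep by (auto simp: M_def trace_tensor)
  ultimately show "locc1_distinguishable_bob_first (density_op ` states)"
    unfolding locc1_distinguishable_bob_first_def by blast
qed

section \<open>Few states\<close>

text \<open>Call \<open>k\<close>, \<open>l\<close> an edge if \<open>b k\<close> and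
  \<open>b l\<close> are not orthogonal. By \<open>sep\<close> each rank-one outcome annihilates an
  end of every edge; by \<open>fixed\<close> one end lies in the span of \<open>U\<close>, so the
  complement annihilates it.\<close>

lemma one_way_orthonormal:
  assumes U: "orthonormal U"
    and sep: "\<And>k l u. \<lbrakk>k \<in> K; l \<in> K; k \<noteq> l; cinner (b k) (b l) \<noteq> 0; u \<in> U\<rbrakk> \<Longrightarrow>
      cinner u (a k) = 0 \<or> cinner u (a l) = 0"
    and fixed: "\<And>k l. \<lbrakk>k \<in> K; l \<in> K; k \<noteq> l; cinner (b k) (b l) \<noteq> 0\<rbrakk> \<Longrightarrow>
      orthoproj U *v a k = a k \<or> orthoproj U *v a l = a l"
  shows "one_way K a b"
proof -
  obtain J and A :: "nat \<Rightarrow> complex^'m^'m" where J: "povm J A"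
    "\<And>j. j \<in> J \<Longrightarrow> (\<exists>u\<in>U. A j = density_op u) \<or> A j = mat 1 - orthoproj U"
    using orthonormal_povm[OF U] by blast
  have "cinner (b k) (b l) = 0 \<or> A j *v a k = 0 \<or> A j *v a l = 0"
    if jkl: "j \<in> J" "k \<in> K" "l \<in> K" "k \<noteq> l" for j k l
  proof (cases "cinner (b k) (b l) = 0")
    case False
    show ?thesis using J(2)[OF jkl(1)]
    proof
      assume "\<exists>u\<in>U. A j = density_op u"
      then obtain u where "u \<in> U" "A j = density_op u" by blast
      then show ?thesis using sep[OF jkl(2-4) False] by (auto simp: density_op_mult)
    next
      assume "A j = mat 1 - orthoproj U"
      then show ?thesis using fixed[OF jkl(2-4) False]
        by (auto simp: matrix_vector_mult_diff_rdistrib)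
    qed
  qed auto
  then show ?thesis unfolding one_way_def using J(1) by blast
qed

lemma one_way_vertex_cover:
  assumes C: "C \<subseteq> K" "\<And>k l. \<lbrakk>k \<in> C; l \<in> C; k \<noteq> l\<rbrakk> \<Longrightarrow> cinner (a k) (a l) = 0"
    and cover: "\<And>k l. \<lbrakk>k \<in> K - C; l \<in> K - C; k \<noteq> l\<rbrakk> \<Longrightarrow> cinner (b k) (b l) = 0"
  shows "one_way K a b"
proof (rule one_way_orthonormal)
  show on: "orthonormal (a ` C)"
    using C norm_a finite_K by (intro orthonormal_image) (auto intro: finite_subset)
  show "orthoproj (a ` C) *v a k = a k \<or> orthoproj (a ` C) *v a l = a l"
    if "k \<in> K" "l \<in> K" "k \<noteq> l" "cinner (b k) (b l) \<noteq> 0" for k l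
    using orthoproj_fixes[OF on] cover[of k l] that by blast
  show "cinner u (a k) = 0 \<or> cinner u (a l) = 0"
    if kl: "k \<in> K" "l \<in> K" "k \<noteq> l" "cinner (b k) (b l) \<noteq> 0" and "u \<in> a ` C" for k l u
  proof -
    obtain c where c: "c \<in> C" "u = a c" using \<open>u \<in> a ` C\<close> by auto
    \<comment> \<open>On an edge the first factors must be orthogonal, which settles
      \<open>c = k\<close> and \<open>c = l\<close>. For any other \<open>c\<close>, an end of the
      edge lies in \<open>C\<close> and is orthogonal to \<open>a c\<close>.\<close>
    have "cinner (a k) (a l) = 0" "cinner (a l) (a k) = 0"
      using orth[OF kl(1-3)] kl(4) cinner_eq_0_commute by blast+
    then show ?thesis using c C(2)[of c k] C(2)[of c l] cover[of k l] kl by auto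
  qed
qed

text \<open>Either one vertex covers all edges, or every pair is an edge; in the latter case all
  first factors are mutually orthogonal and \<open>K\<close> itself is the cover.\<close>

lemma one_way_at_most_3:
  assumes "card K \<le> 3"
  shows "one_way K a b"
proof (cases "\<exists>c\<in>K. \<forall>k\<in>K - {c}. \<forall>l\<in>K - {c}. k \<noteq> l \<longrightarrow> cinner (b k) (b l) = 0")
  case True
  then obtain c where "c \<in> K" "\<forall>k\<in>K - {c}. \<forall>l\<in>K - {c}. k \<noteq> l \<longrightarrow> cinner (b k) (b l) = 0"
    by blast
  then show ?thesis by (intro one_way_vertex_cover[of "{c}"]) auto
next
  case False
  have "cinner (a k) (a l) = 0" if kl: "k \<in> K" "l \<in> K" "k \<noteq> l" for k l
  proof (cases "K = {k, l}")
    case True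
    then show ?thesis using False kl by auto
  next
    case neq: False
    then obtain c where c: "c \<in> K" "c \<noteq> k" "c \<noteq> l" using kl by auto
    \<comment> \<open>With only three labels, the failure of \<open>{c}\<close> as a cover makes the
      remaining pair \<open>k\<close>, \<open>l\<close> an edge.\<close>
    have "K = {c, k, l}"
      using c kl assms finite_K card_subset_eq[of K "{c, k, l}"] card_mono[of K "{c, k, l}"] by auto
    then have "cinner (b k) (b l) \<noteq> 0" using False c cinner_eq_0_commute[of "b k" "b l"] by auto
    then show ?thesis using orth[OF kl] by simp
  qed
  then show ?thesis by (intro one_way_vertex_cover[of K]) auto
qed

text \<open>All edges run between \<open>{p, q}\<close> and \<open>{r, s}\<close>. As
  \<open>a p\<close> and \<open>a q\<close> need not be orthogonal, a basis of their span is
  measured: its vectors annihilate \<open>r\<close> and \<open>s\<close>, and the complement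
  annihilates \<open>p\<close> and \<open>q\<close>.\<close>

lemma one_way_4_cycle:
  assumes K: "K = {p, q, r, s}" and pq: "cinner (b p) (b q) = 0" and rs: "cinner (b r) (b s) = 0"
    and "cinner (a p) (a r) = 0" "cinner (a p) (a s) = 0" "cinner (a q) (a r) = 0" "cinner (a q) (a s) = 0"
  shows "one_way K a b"
proof -
  obtain U where U: "orthonormal U" "orthoproj U *v a p = a p" "orthoproj U *v a q = a q"
    "\<And>u z. \<lbrakk>u \<in> U; cinner (a p) z = 0; cinner (a q) z = 0\<rbrakk> \<Longrightarrow> cinner u z = 0"
    using orthonormal_basis_of_pair[of "a p" "a q"] norm_a K by (metis insertI1)
  have *: "cinner (b q) (b p) = 0" "cinner (b s) (b r) = 0"
    using pq rs cinner_eq_0_commute by blast+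
  show ?thesis
    by (rule one_way_orthonormal[OF U(1)]) (use U assms * in auto)
qed

lemma one_way_matching:
  assumes K: "K = {p, q, r, s}" and "cinner (a p) (a q) = 0" and "cinner (b r) (b s) = 0"
  shows "one_way K a b"
proof -
  have "cinner (a q) (a p) = 0" "cinner (b s) (b r) = 0"
    using assms cinner_eq_0_commute by blast+
  then show ?thesis using assms by (intro one_way_vertex_cover[of "{p, q}"]) auto
qed

end

section \<open>Four states in a suitable order\<close>

lemma product_states_swap: "product_states K a b \<Longrightarrow> product_states K b a"
  unfolding product_states_def by blast

lemma one_way_4:
  assumes "product_states K a b" "card K = 4"
  shows "one_way K a b \<or> one_way K b a"
proof -
  interpret product_states K a b by fact
  interpret swap: product_states K b a by (rule product_states_swap) fact
  obtain p q r s where K: "K = {p, q, r, s}" and ne: "distinct [p, q, r, s]"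
    using assms(2) by (auto simp: card_Suc_eq numeral_eq_Suc)
  have perms: "K = {r, s, p, q}" "K = {p, r, q, s}" "K = {q, s, p, r}" "K = {p, s, q, r}"
    "K = {q, r, p, s}" "K = {p, q, s, r}" "K = {p, r, s, q}" using K by auto
  define \<alpha> where "\<alpha> k l \<longleftrightarrow> cinner (a k) (a l) = 0" for k l
  define \<beta> where "\<beta> k l \<longleftrightarrow> cinner (b k) (b l) = 0" for k l
  note defs = \<alpha>_def[symmetric] \<beta>_def[symmetric]
  have sym: "\<alpha> k l = \<alpha> l k" "\<beta> k l = \<beta> l k" for k l
    using cinner_eq_0_commute by (auto simp: \<alpha>_def \<beta>_def)
  have or: "\<alpha> p q \<or> \<beta> p q" "\<alpha> p r \<or> \<beta> p r" "\<alpha> p s \<or> \<beta> p s" "\<alpha> q r \<or> \<beta> q r" "\<alpha> q s \<or> \<beta> q s" "\<alpha> r s \<or> \<beta> r s"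
    using orth K ne by (auto simp: \<alpha>_def \<beta>_def)
  note matching = one_way_matching[unfolded defs]
  note cycle = one_way_4_cycle[unfolded defs] swap.one_way_4_cycle[unfolded defs]
  have all_a: "one_way K a b" if "\<alpha> p q" "\<alpha> p r" "\<alpha> p s" "\<alpha> q r" "\<alpha> q s" "\<alpha> r s"
    using that sym K by (intro one_way_vertex_cover[of K]) (auto simp flip: \<alpha>_def)
  have all_b: "one_way K b a" if "\<beta> p q" "\<beta> p r" "\<beta> p s" "\<beta> q r" "\<beta> q s" "\<beta> r s"
    using that sym K by (intro swap.one_way_vertex_cover[of K]) (auto simp flip: \<beta>_def)
  show ?thesis
  proof (rule ccontr)
    assume neg: "\<not> ?thesis"
    \<comment> \<open>No perfect matching is split between the parties. With \<open>or\<close>, both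
      of its pairs are then orthogonal for the same single party.\<close>
    have m: "\<not> (\<alpha> p q \<and> \<beta> r s)" "\<not> (\<alpha> r s \<and> \<beta> p q)" "\<not> (\<alpha> p r \<and> \<beta> q s)"
      "\<not> (\<alpha> q s \<and> \<beta> p r)" "\<not> (\<alpha> p s \<and> \<beta> q r)" "\<not> (\<alpha> q r \<and> \<beta> p s)"
      using neg matching[OF K] matching[OF perms(1)] matching[OF perms(2)] matching[OF perms(3)]
        matching[OF perms(4)] matching[OF perms(5)] by blast+
    \<comment> \<open>The case where Bob owns exactly one matching, for each of the three choices;
      \<open>cb\<close> is its mirror image. Ownership of all three is left to \<open>all_a\<close>
      and \<open>all_b\<close>.\<close>
    have ca: "\<not> (\<beta> p q \<and> \<beta> r s \<and> \<alpha> p r \<and> \<alpha> p s \<and> \<alpha> q r \<and> \<alpha> q s)"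
      "\<not> (\<beta> p r \<and> \<beta> q s \<and> \<alpha> p q \<and> \<alpha> p s \<and> \<alpha> r q \<and> \<alpha> r s)"
      "\<not> (\<beta> p s \<and> \<beta> q r \<and> \<alpha> p q \<and> \<alpha> p r \<and> \<alpha> s q \<and> \<alpha> s r)"
      using neg cycle(1)[OF K] cycle(1)[OF perms(2)] cycle(1)[OF perms(4)] by blast+
    have cb: "\<not> (\<alpha> p q \<and> \<alpha> r s \<and> \<beta> p r \<and> \<beta> p s \<and> \<beta> q r \<and> \<beta> q s)"
      "\<not> (\<alpha> p r \<and> \<alpha> q s \<and> \<beta> p q \<and> \<beta> p s \<and> \<beta> r q \<and> \<beta> r s)"
      "\<not> (\<alpha> p s \<and> \<alpha> q r \<and> \<beta> p q \<and> \<beta> p r \<and> \<beta> s q \<and> \<beta> s r)"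
      using neg cycle(2)[OF K] cycle(2)[OF perms(2)] cycle(2)[OF perms(4)] by blast+
    show False
      using or m ca cb neg all_a all_b sym[of r q] sym[of s q] sym[of s r] by argo
  qed
qed

text \<open>Each vector labels itself, with a choice of unit factors; orthogonality passes to one
  factor because \<open>cinner\<close> is multiplicative on tensors.\<close>

lemma product_vectors_states:
  fixes V :: "(complex^('m::finite \<times> 'n::finite)) set"
  assumes V: "V \<subseteq> product_vectors" "mutually_orthogonal V" "finite V"
  obtains a and b where "product_states V a b" "(\<lambda>v. tensor_vec (a v) (b v)) ` V = V"
proof -
  have "\<forall>v\<in>V. \<exists>a b. v = tensor_vec a b \<and> norm a = 1 \<and> norm b = 1"
    using V(1) by (auto simp: product_vectors_def)
  then obtain a b where ab: "\<And>v. v \<in> V \<Longrightarrow> v = tensor_vec (a v) (b v) \<and> norm (a v) = 1 \<and> norm (b v) = 1"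
    by metis
  have "cinner (a v) (a w) = 0 \<or> cinner (b v) (b w) = 0" if "v \<in> V" "w \<in> V" "v \<noteq> w" for v w
    using V(2) that ab cinner_tensor_vec[of "a v" "b v" "a w" "b w"]
    by (auto simp: mutually_orthogonal_def pairwise_def)
  then have "product_states V a b" using ab V(3) by unfold_locales auto
  moreover have "(\<lambda>v. tensor_vec (a v) (b v)) ` V = V" using ab by force
  ultimately show thesis using that by blast
qed

section \<open>Indistinguishable states\<close>

text \<open>Lets the counterexamples be written with unnormalised vectors, \<open>sgn\<close>
  supplying the normalisation; by symmetry only pairs with \<open>i < j\<close> have to be
  checked.\<close>

lemma product_states_sgn:
  fixes xs :: "(complex^'m::finite) list" and ys :: "(complex^'n::finite) list"
  assumes "length ys = length xs" "0 \<notin> set xs" "0 \<notin> set ys"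
    and orth: "\<And>i j. \<lbrakk>i < j; j < length xs\<rbrakk> \<Longrightarrow> cinner (xs ! i) (xs ! j) = 0 \<or> cinner (ys ! i) (ys ! j) = 0"
  shows "product_states {..<length xs} (\<lambda>k. sgn (xs ! k)) (\<lambda>k. sgn (ys ! k))"
proof
  have nz: "xs ! k \<noteq> 0" "ys ! k \<noteq> 0" if "k < length xs" for k
    using that assms(1-3) by (metis nth_mem)+
  show "finite {..<length xs}" by simp
  show "norm (sgn (xs ! k)) = 1" "norm (sgn (ys ! k)) = 1" if "k \<in> {..<length xs}" for k
    using nz[of k] that by (auto simp: norm_sgn)
  show "cinner (sgn (xs ! k)) (sgn (xs ! l)) = 0 \<or> cinner (sgn (ys ! k)) (sgn (ys ! l)) = 0"
    if "k \<in> {..<length xs}" "l \<in> {..<length xs}" "k \<noteq> l" for k l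
    using that nz[of k] nz[of l] orth[of k l] orth[of l k]
    by (cases k l rule: linorder_cases) (auto simp: cinner_sgn_eq_0 cinner_eq_0_commute)
qed

text \<open>Removes the normalisation again: nonzero scaling changes neither orthogonality nor
  membership in a kernel.\<close>

lemma one_way_sgnD:
  assumes "one_way {..<length xs} (\<lambda>k. sgn (xs ! k)) (\<lambda>k. sgn (ys ! k))"
    and "length ys = length xs" "0 \<notin> set xs" "0 \<notin> set ys"
  obtains J :: "nat set" and A where "povm J A"
    "\<And>j k l. \<lbrakk>j \<in> J; k < length xs; l < length xs; k \<noteq> l; cinner (ys ! k) (ys ! l) \<noteq> 0\<rbrakk> \<Longrightarrow>
      A j *v (xs ! k) = 0 \<or> A j *v (xs ! l) = 0"
proof -
  have nz: "xs ! k \<noteq> 0" "ys ! k \<noteq> 0" if "k < length xs" for k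
    using that assms(2-4) by (metis nth_mem)+
  obtain J :: "nat set" and A where J: "povm J A"
    and sep: "\<forall>j\<in>J. \<forall>k\<in>{..<length xs}. \<forall>l\<in>{..<length xs}. k \<noteq> l \<longrightarrow>
      cinner (sgn (ys ! k)) (sgn (ys ! l)) = 0 \<or> A j *v sgn (xs ! k) = 0 \<or> A j *v sgn (xs ! l) = 0"
    using assms(1) unfolding one_way_def by (elim exE conjE)
  show thesis
  proof (rule that[OF J])
    fix j k l
    assume jkl: "j \<in> J" "k < length xs" "l < length xs" "k \<noteq> l" "cinner (ys ! k) (ys ! l) \<noteq> 0"
    then have "cinner (sgn (ys ! k)) (sgn (ys ! l)) \<noteq> 0" using nz cinner_sgn_eq_0 by blast
    then have "A j *v sgn (xs ! k) = 0 \<or> A j *v sgn (xs ! l) = 0" using sep jkl by blast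
    then show "A j *v (xs ! k) = 0 \<or> A j *v (xs ! l) = 0"
      using nz jkl matrix_vector_mult_sgn_eq_0 by blast
  qed
qed

lemma povm_common_kernel:
  assumes "povm J A" "\<And>j. j \<in> J \<Longrightarrow> A j *v (x :: complex^'d) = 0"
  shows "x = 0"
  using povm_resolution[OF assms(1), of x] assms(2) by simp

lemmas cinner_simps = cinner_add_left cinner_add_right cinner_diff_left cinner_diff_right cinner_axis

lemma combination_axes_nonzero:
  assumes "i \<noteq> j"
  shows "axis i (1 :: complex) \<noteq> 0" "axis i (1 :: complex) + axis j 1 \<noteq> 0"
    "axis i (1 :: complex) - axis j 1 \<noteq> 0"
  using assms by (auto simp: vec_eq_iff axis_def intro!: exI[of _ i])

text \<open>The edges are the pairs \<open>0, 1\<close> and \<open>2, 3\<close>. Annihilating one of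
  \<open>e0\<close>, \<open>e1\<close> and one of \<open>e0 + e1\<close>, \<open>e0 - e1\<close>
  annihilates \<open>e0\<close>, so every outcome would, against the resolution of the
  identity.\<close>

lemma four_states_not_alice_first:
  assumes "CARD('m::finite) \<ge> 2" "CARD('n::finite) \<ge> 2"
  obtains V :: "(complex^('m::finite \<times> 'n::finite)) set" where "V \<subseteq> product_vectors" "mutually_orthogonal V"
    "finite V" "card V \<le> 4" "\<not> locc1_distinguishable_alice_first (density_op ` V)"
proof -
  obtain i j :: 'm where ij: "i \<noteq> j"
    using assms(1) by (metis UNIV_I card_2_iff' ex_card numeral_le_iff)
  obtain k l :: 'n where kl: "k \<noteq> l"
    using assms(2) by (metis UNIV_I card_2_iff' ex_card numeral_le_iff)
  define e0 e1 :: "complex^'m" where "e0 = axis i 1" and "e1 = axis j 1"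
  define f0 f1 :: "complex^'n" where "f0 = axis k 1" and "f1 = axis l 1"
  note e_defs = e0_def e1_def f0_def f1_def
  define xs where "xs = [e0, e1, e0 + e1, e0 - e1]"
  define ys where "ys = [f0, f0, f1, f1]"
  have len: "length xs = 4" "length ys = length xs" by (simp_all add: xs_def ys_def)
  have nz: "0 \<notin> set xs" "0 \<notin> set ys"
    using combination_axes_nonzero[of i j] combination_axes_nonzero[of j i]
      combination_axes_nonzero[of k l] combination_axes_nonzero[of l k] ij kl
    by (auto simp: xs_def ys_def e_defs)
  interpret product_states "{..<length xs}" "\<lambda>k. sgn (xs ! k)" "\<lambda>k. sgn (ys ! k)"
  proof (rule product_states_sgn[OF len(2) nz])
    fix m n assume "m < n" "n < length xs"
    then show "cinner (xs ! m) (xs ! n) = 0 \<or> cinner (ys ! m) (ys ! n) = 0"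
      using ij kl by (auto simp: xs_def ys_def less_Suc_eq numeral_eq_Suc cinner_simps e_defs)
  qed
  have "\<not> one_way {..<length xs} (\<lambda>k. sgn (xs ! k)) (\<lambda>k. sgn (ys ! k))"
  proof
    assume "one_way {..<length xs} (\<lambda>k. sgn (xs ! k)) (\<lambda>k. sgn (ys ! k))"
    from one_way_sgnD[OF this len(2) nz]
    obtain J :: "nat set" and A where J: "povm J A"
      "\<And>j k l. \<lbrakk>j \<in> J; k < length xs; l < length xs; k \<noteq> l; cinner (ys ! k) (ys ! l) \<noteq> 0\<rbrakk> \<Longrightarrow>
        A j *v (xs ! k) = 0 \<or> A j *v (xs ! l) = 0" by blast
    have "A m *v e0 = 0" if "m \<in> J" for m
    proof -
      have "A m *v e0 = 0 \<or> A m *v e1 = 0"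
        using J(2)[OF that, of 0 1] by (simp add: xs_def ys_def e_defs cinner_simps)
      moreover have "A m *v (e0 + e1) = 0 \<or> A m *v (e0 - e1) = 0"
        using J(2)[OF that, of 2 3] by (simp add: xs_def ys_def e_defs cinner_simps)
      ultimately show ?thesis
        by (auto simp: matrix_vector_right_distrib matrix_vector_mult_diff_distrib)
    qed
    then have "e0 = 0" using povm_common_kernel[OF J(1)] by blast
    then show False using combination_axes_nonzero[OF ij] by (simp add: e_defs)
  qed
  moreover have "finite states" "card states \<le> 4"
    using finite_K card_image_le[OF finite_K] by (auto simp: len)
  ultimately show thesis
    using that[OF states_product states_orthogonal] alice_first_iff by blast
qed

text \<open>The hypotheses are the edges of the cycle \<open>x\<close>, \<open>z\<close>,
  \<open>x - y\<close>, \<open>x + y + z\<close>, \<open>y - z\<close>. If \<open>x\<close> were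
  nonzero, its neighbours \<open>z\<close> and \<open>y - z\<close> would vanish, hence
  \<open>y\<close> too; but then the edge between \<open>x - y\<close> and \<open>x + y + z\<close>
  gives \<open>x = 0\<close>.\<close>

lemma annihilates_5_cycle_cover:
  fixes x y z :: "'a::real_vector"
  assumes "x = 0 \<or> z = 0" "z = 0 \<or> x - y = 0" "x - y = 0 \<or> x + y + z = 0"
    "x + y + z = 0 \<or> y - z = 0" "y - z = 0 \<or> x = 0"
  shows "x = 0"
proof -
  have "x + x = 0 \<longleftrightarrow> x = 0" by (metis scaleR_2 scaleR_eq_0_iff zero_neq_numeral)
  then show ?thesis using assms by auto
qed

lemma five_states_not_one_way:
  assumes "CARD('m::finite) \<ge> 3" "CARD('n::finite) \<ge> 3"
  obtains V :: "(complex^('m::finite \<times> 'n::finite)) set" where "V \<subseteq> product_vectors" "mutually_orthogonal V"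
    "finite V" "card V \<le> 5" "\<not> locc1_distinguishable_alice_first (density_op ` V)"
    "\<not> locc1_distinguishable_bob_first (density_op ` V)"
proof -
  have three: "\<exists>p q r :: 'x. p \<noteq> q \<and> p \<noteq> r \<and> q \<noteq> r" if "CARD('x::finite) \<ge> 3"
    using ex_card[OF that] by (metis card_3_iff)
  obtain i0 i1 i2 :: 'm where i: "i0 \<noteq> i1" "i0 \<noteq> i2" "i1 \<noteq> i2" using three[OF assms(1)] by blast
  obtain j0 j1 j2 :: 'n where j: "j0 \<noteq> j1" "j0 \<noteq> j2" "j1 \<noteq> j2" using three[OF assms(2)] by blast
  define e0 e1 e2 :: "complex^'m" where "e0 = axis i0 1" and "e1 = axis i1 1" and "e2 = axis i2 1"
  define f0 f1 f2 :: "complex^'n" where "f0 = axis j0 1" and "f1 = axis j1 1" and "f2 = axis j2 1"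
  note e_defs = e0_def e1_def e2_def f0_def f1_def f2_def
  \<comment> \<open>Alice's edges form the cycle \<open>0, 1, 2, 4, 3\<close>. Bob's edges are
    exactly the other five pairs, forming the cycle \<open>3, 2, 0, 4, 1\<close>. Along each cycle
    the measured vectors follow the pattern of \<open>annihilates_5_cycle_cover\<close>.\<close>
  define xs where "xs = [e0, e2, e0 - e1, e1 - e2, e0 + e1 + e2]"
  define ys where "ys = [f0 - f1, f1 - f2, f2, f0, f0 + f1 + f2]"
  have len: "length xs = 5" "length ys = length xs" "length xs = length ys"
    by (simp_all add: xs_def ys_def)
  have sum3: "axis p (1 :: complex) + axis q 1 + axis r 1 \<noteq> 0" if "p \<noteq> q" "p \<noteq> r" for p q r :: "'x::finite"
    using that by (auto simp: vec_eq_iff axis_def intro!: exI[of _ p])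
  have nz: "0 \<notin> set xs" "0 \<notin> set ys"
    using combination_axes_nonzero[OF i(1)] combination_axes_nonzero[OF i(3)]
      combination_axes_nonzero[OF i(3)[symmetric]] sum3[OF i(1,2)]
      combination_axes_nonzero[OF j(1)] combination_axes_nonzero[OF j(3)]
      combination_axes_nonzero[OF j(3)[symmetric]] sum3[OF j(1,2)]
    by (auto simp: xs_def ys_def e_defs)
  interpret product_states "{..<length xs}" "\<lambda>k. sgn (xs ! k)" "\<lambda>k. sgn (ys ! k)"
  proof (rule product_states_sgn[OF len(2) nz])
    fix m n assume "m < n" "n < length xs"
    then show "cinner (xs ! m) (xs ! n) = 0 \<or> cinner (ys ! m) (ys ! n) = 0"
      using i j by (auto simp: xs_def ys_def less_Suc_eq numeral_eq_Suc cinner_simps e_defs)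
  qed
  have "\<not> one_way {..<length xs} (\<lambda>k. sgn (xs ! k)) (\<lambda>k. sgn (ys ! k))"
  proof
    assume "one_way {..<length xs} (\<lambda>k. sgn (xs ! k)) (\<lambda>k. sgn (ys ! k))"
    from one_way_sgnD[OF this len(2) nz]
    obtain J :: "nat set" and A where J: "povm J A"
      "\<And>j k l. \<lbrakk>j \<in> J; k < length xs; l < length xs; k \<noteq> l; cinner (ys ! k) (ys ! l) \<noteq> 0\<rbrakk> \<Longrightarrow>
        A j *v (xs ! k) = 0 \<or> A j *v (xs ! l) = 0" by blast
    have "A m *v e0 = 0" if m: "m \<in> J" for m
      using J(2)[OF m, of 0 1] J(2)[OF m, of 1 2] J(2)[OF m, of 2 4] J(2)[OF m, of 4 3]
        J(2)[OF m, of 3 0] i j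
      by (intro annihilates_5_cycle_cover[of _ "A m *v e2" "A m *v e1"])
        (simp_all add: xs_def ys_def e_defs cinner_simps matrix_vector_right_distrib
          matrix_vector_mult_diff_distrib)
    then have "e0 = 0" using povm_common_kernel[OF J(1)] by blast
    then show False using combination_axes_nonzero[OF i(1)] by (simp add: e_defs)
  qed
  moreover have "\<not> one_way {..<length xs} (\<lambda>k. sgn (ys ! k)) (\<lambda>k. sgn (xs ! k))"
  proof
    assume "one_way {..<length xs} (\<lambda>k. sgn (ys ! k)) (\<lambda>k. sgn (xs ! k))"
    then have "one_way {..<length ys} (\<lambda>k. sgn (ys ! k)) (\<lambda>k. sgn (xs ! k))" by (simp add: len)
    from one_way_sgnD[OF this len(3) nz(2,1)]
    obtain J :: "nat set" and A where J: "povm J A"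
      "\<And>j k l. \<lbrakk>j \<in> J; k < length ys; l < length ys; k \<noteq> l; cinner (xs ! k) (xs ! l) \<noteq> 0\<rbrakk> \<Longrightarrow>
        A j *v (ys ! k) = 0 \<or> A j *v (ys ! l) = 0" by blast
    have "A m *v f0 = 0" if m: "m \<in> J" for m
      using J(2)[OF m, of 3 2] J(2)[OF m, of 2 0] J(2)[OF m, of 0 4] J(2)[OF m, of 4 1]
        J(2)[OF m, of 1 3] i j
      by (intro annihilates_5_cycle_cover[of _ "A m *v f2" "A m *v f1"])
        (simp_all add: xs_def ys_def e_defs cinner_simps matrix_vector_right_distrib
          matrix_vector_mult_diff_distrib)
    then have "f0 = 0" using povm_common_kernel[OF J(1)] by blast
    then show False using combination_axes_nonzero[OF j(1)] by (simp add: e_defs)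
  qed
  moreover have "finite states" "card states \<le> 5"
    using finite_K card_image_le[OF finite_K] by (auto simp: len)
  ultimately show thesis
    using that[OF states_product states_orthogonal] alice_first_iff bob_first_iff by blast
qed

theorem corollary2:
  shows "(CARD('m::finite) \<ge> 3 \<and> CARD('n::finite) \<ge> 2 \<longrightarrow>
      is_maximal_number
        (\<lambda>P. \<forall>V :: (complex^('m \<times> 'n)) set.
           V \<subseteq> product_vectors \<and> mutually_orthogonal V \<and> finite V \<and> card V \<le> P \<longrightarrow>
           locc1_distinguishable_alice_first (density_op ` V)) 3) \<and>
    (CARD('m) \<ge> 3 \<and> CARD('n) \<ge> 3 \<longrightarrow>
      is_maximal_number
        (\<lambda>Q. \<forall>V :: (complex^('m \<times> 'n)) set.
           V \<subseteq> product_vectors \<and> mutually_orthogonal V \<and> finite V \<and> card V \<le> Q \<longrightarrow>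
           locc1_distinguishable_alice_first (density_op ` V) \<or>
           locc1_distinguishable_bob_first (density_op ` V)) 4)"
proof (intro conjI impI; elim conjE)
  have alice: "locc1_distinguishable_alice_first (density_op ` V)"
    if V: "V \<subseteq> product_vectors" "mutually_orthogonal V" "finite V" "card V \<le> 3"
    for V :: "(complex^('m \<times> 'n)) set"
  proof -
    obtain a b where ab: "product_states V a b" "(\<lambda>v. tensor_vec (a v) (b v)) ` V = V"
      using product_vectors_states[OF V(1-3)] by blast
    then show ?thesis
      using product_states.alice_first_iff product_states.one_way_at_most_3 V(4) by metis
  qed
  have either: "locc1_distinguishable_alice_first (density_op ` V) \<or>
      locc1_distinguishable_bob_first (density_op ` V)"
    if V: "V \<subseteq> product_vectors" "mutually_orthogonal V" "finite V" "card V \<le> 4"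
    for V :: "(complex^('m \<times> 'n)) set"
  proof (cases "card V \<le> 3")
    case True
    then show ?thesis using alice V by blast
  next
    case False
    obtain a b where ab: "product_states V a b" "(\<lambda>v. tensor_vec (a v) (b v)) ` V = V"
      using product_vectors_states[OF V(1-3)] by blast
    then show ?thesis
      using product_states.alice_first_iff[OF ab(1)] product_states.bob_first_iff[OF ab(1)]
        one_way_4[OF ab(1)] V(4) False by simp
  qed
  show "is_maximal_number
        (\<lambda>P. \<forall>V :: (complex^('m \<times> 'n)) set.
           V \<subseteq> product_vectors \<and> mutually_orthogonal V \<and> finite V \<and> card V \<le> P \<longrightarrow>
           locc1_distinguishable_alice_first (density_op ` V)) 3"
    if dims: "CARD('m) \<ge> 3" "CARD('n) \<ge> 2"
  proof -
    obtain V :: "(complex^('m \<times> 'n)) set" where V: "V \<subseteq> product_vectors" "mutually_orthogonal V"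
      "finite V" "card V \<le> 4" "\<not> locc1_distinguishable_alice_first (density_op ` V)"
      by (rule four_states_not_alice_first[where 'm = 'm and 'n = 'n]) (use dims in auto)
    \<comment> \<open>A single set with \<open>card V \<le> 4\<close> refutes every
      \<open>k' \<ge> 4\<close> at once, since the property quantifies over all sets of at most
      \<open>k'\<close> states.\<close>
    have "k' \<le> 3" if "\<forall>V :: (complex^('m \<times> 'n)) set.
           V \<subseteq> product_vectors \<and> mutually_orthogonal V \<and> finite V \<and> card V \<le> k' \<longrightarrow>
           locc1_distinguishable_alice_first (density_op ` V)" for k'
    proof (rule ccontr)
      assume "\<not> k' \<le> 3"
      then have "card V \<le> k'" using \<open>card V \<le> 4\<close> by simp
      then show False using that V by blast
    qed
    then show ?thesis unfolding is_maximal_number_def using alice by blast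
  qed
  show "is_maximal_number
        (\<lambda>Q. \<forall>V :: (complex^('m \<times> 'n)) set.
           V \<subseteq> product_vectors \<and> mutually_orthogonal V \<and> finite V \<and> card V \<le> Q \<longrightarrow>
           locc1_distinguishable_alice_first (density_op ` V) \<or>
           locc1_distinguishable_bob_first (density_op ` V)) 4"
    if dims: "CARD('m) \<ge> 3" "CARD('n) \<ge> 3"
  proof -
    obtain V :: "(complex^('m \<times> 'n)) set" where V: "V \<subseteq> product_vectors" "mutually_orthogonal V"
      "finite V" "card V \<le> 5" "\<not> locc1_distinguishable_alice_first (density_op ` V)"
      "\<not> locc1_distinguishable_bob_first (density_op ` V)"
      by (rule five_states_not_one_way[OF dims])
    have "k' \<le> 4" if "\<forall>V :: (complex^('m \<times> 'n)) set.
           V \<subseteq> product_vectors \<and> mutually_orthogonal V \<and> finite V \<and> card V \<le> k' \<longrightarrow>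
           locc1_distinguishable_alice_first (density_op ` V) \<or>
           locc1_distinguishable_bob_first (density_op ` V)" for k'
    proof (rule ccontr)
      assume "\<not> k' \<le> 4"
      then have "card V \<le> k'" using \<open>card V \<le> 5\<close> by simp
      then show False using that V by blast
    qed
    then show ?thesis unfolding is_maximal_number_def using either by blast
  qed
qed

end
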